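(* The sample complexity of learning discrete distributions over a known domain of size $k$ in Hellinger distance, to accuracy $\varepsilon$ and with error probability $\delta$, satisfies $$\Phi(\mathrm{d}_{\rm H},k,\varepsilon,\delta) = \Theta\left(\frac{k+\log(1/\delta)}{\varepsilon^2}\right).$$
   Context: Let $[k]=\{1,\dots,k\}$ and let $\Delta([k])$ be the set of probability distributions on $[k]$. For $p,q\in\Delta([k])$, the Hellinger distance is $\mathrm{d}_{\rm H}(p,q)=\frac{1}{\sqrt2}\sqrt{\sum_{i=1}^k(\sqrt{p(i)}-\sqrt{q(i)})^2}\in[0,1]$. For a distance measure $\mathrm{d}$, an accuracy $\varepsilon>0$ and an error probability $\delta\in(0,1]$, $\Phi(\mathrm{d},k,\varepsilon,\delta)$ denotes the sample complexity of learning discrete distributions over the known domain $[k]$. That is, it is the smallest integer $n$ for which there is a (possibly randomized) estimator which, given $n$ i.i.d. samples from an unknown $p\in\Delta([k])$, outputs $\hat p\in\Delta([k])$ such that, for every $p\in\Delta([k])$, $\Pr[\mathrm{d}(p,\hat p)\le\varepsilon]\ge 1-\delta$. Asymptotics are taken with regard to $k$ going to infinity, $\varepsilon$ going to $0$, and $\delta$ going to $0$ (in that order). Thus $\Phi=\Theta(g)$ means that there are absolute constants $0<c\le C$, $k_0$, $\varepsilon_0>0$, $\delta_0>0$ such that $c\,g\le\Phi\le C\,g$ for all $k\ge k_0$, $0<\varepsilon\le\varepsilon_0$, $0<\delta\le\delta_0$. *)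

theory Defs
  imports "HOL-Probability.Probability"
begin

definition distributions :: "nat \<Rightarrow> nat pmf set" where
  "distributions k = {p. set_pmf p \<subseteq> {1..k}}"

definition hellinger_dist :: "nat \<Rightarrow> nat pmf \<Rightarrow> nat pmf \<Rightarrow> real" where
  "hellinger_dist k p q =
     1 / sqrt 2 * sqrt (\<Sum>i=1..k. (sqrt (pmf p i) - sqrt (pmf q i))\<^sup>2)"

text \<open>
  The Borel structure that the simplex inherits from its embedding
  \<open>p \<mapsto> (p(i))\<^sub>i\<close> into a product of copies of the reals.
\<close>

definition distributions_borel :: "nat \<Rightarrow> nat pmf measure" where
  "distributions_borel k = vimage_algebra (distributions k) pmf borel"

text \<open>
  A randomized estimator is a Markov kernel: a sample \<open>xs\<close> is mapped to the law of the
  estimate. The sample space \<open>[k]\<^sup>n\<close> is finite and discrete, so there is no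
  measurability condition in \<open>xs\<close>.
\<close>

definition randomized_estimators :: "nat \<Rightarrow> nat \<Rightarrow> (nat list \<Rightarrow> nat pmf measure) set" where
  "randomized_estimators k n =
     {xs. length xs = n \<and> set xs \<subseteq> {1..k}} \<rightarrow> space (prob_algebra (distributions_borel k))"

text \<open>
  The probability, over \<open>n\<close> i.i.d. samples from \<open>p\<close> and the internal randomness of the
  estimator, that the estimate is within distance \<open>\<epsilon>\<close> of \<open>p\<close>.
\<close>

definition success_prob ::
  "(nat pmf \<Rightarrow> nat pmf \<Rightarrow> real) \<Rightarrow> nat \<Rightarrow> nat \<Rightarrow> real \<Rightarrow> (nat list \<Rightarrow> nat pmf measure) \<Rightarrow> nat pmf \<Rightarrow> real"
  where
  "success_prob d k n \<epsilon> A p =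
     measure_pmf.expectation (replicate_pmf n p)
       (\<lambda>xs. measure (A xs) {q \<in> distributions k. d p q \<le> \<epsilon>})"

definition learnable ::
  "(nat pmf \<Rightarrow> nat pmf \<Rightarrow> real) \<Rightarrow> nat \<Rightarrow> real \<Rightarrow> real \<Rightarrow> nat \<Rightarrow> bool" where
  "learnable d k \<epsilon> \<delta> n \<longleftrightarrow>
     (\<exists>A \<in> randomized_estimators k n. \<forall>p \<in> distributions k. success_prob d k n \<epsilon> A p \<ge> 1 - \<delta>)"

text \<open>
  The least sample size that suffices; it is \<open>\<infinity>\<close> when no sample size does, so a finite
  upper bound includes the existence of an estimator.
\<close>

definition sample_complexity ::
  "(nat pmf \<Rightarrow> nat pmf \<Rightarrow> real) \<Rightarrow> nat \<Rightarrow> real \<Rightarrow> real \<Rightarrow> enat" where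
  "sample_complexity d k \<epsilon> \<delta> = Inf {enat n | n. learnable d k \<epsilon> \<delta> n}"

text \<open>
  The success event is measurable, so that \<^const>\<open>success_prob\<close> is the intended probability
  (\<^const>\<open>measure\<close> is \<open>0\<close> on non-measurable sets).
\<close>

lemma pmf_measurable_distributions_borel [measurable]:
  "(\<lambda>q. pmf q i) \<in> borel_measurable (distributions_borel k)"
proof -
  have 1: "pmf \<in> distributions_borel k \<rightarrow>\<^sub>M (borel :: (nat \<Rightarrow> real) measure)"
    unfolding distributions_borel_def by (rule measurable_vimage_algebra1) auto
  have 2: "(\<lambda>f. f i) \<in> (borel :: (nat \<Rightarrow> real) measure) \<rightarrow>\<^sub>M borel"
    by (intro borel_measurable_continuous_onI continuous_on_product_coordinates)
  from measurable_compose[OF 1 2] show ?thesis .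
qed

lemma hellinger_ball_measurable:
  "{q \<in> distributions k. hellinger_dist k p q \<le> \<epsilon>} \<in> sets (distributions_borel k)"
proof -
  have [simp]: "space (distributions_borel k) = distributions k"
    by (simp add: distributions_borel_def)
  have "(\<lambda>q. hellinger_dist k p q) \<in> borel_measurable (distributions_borel k)"
    unfolding hellinger_dist_def by measurable
  then have "{q \<in> space (distributions_borel k). hellinger_dist k p q \<le> \<epsilon>}
      \<in> sets (distributions_borel k)"
    by measurable
  then show ?thesis by simp
qed

end

theory Submission
  imports Defs
begin

text \<open>
  Upper bound: the empirical distribution \<open>q\<close> of \<open>n\<close> samples satisfies
  \<open>E exp (n d\<^sub>H(p, q)\<^sup>2) \<le> 4\<^sup>k\<close>, so Markov's inequality gives the failure probability
  \<open>4\<^sup>k exp (- n \<epsilon>\<^sup>2)\<close>. As \<open>ln x \<le> x - 1\<close>, the exponential is at most the square root of the likelihood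
  ratio between \<open>q\<close> and \<open>p\<close>. The expectation of the latter is bounded by peeling
  off one letter of the alphabet at a time, at the cost of a factor \<open>4\<close>: this is the binomial case,
  where Chernoff's bound says that the likelihood ratio at \<open>j\<close> is at most the inverse of the tail
  probability \<open>S j\<close> beyond \<open>j\<close>, and \<open>\<Sum>j. P(X = j) / sqrt (S j) \<le> 2\<close> over either tail, by telescoping.

  Lower bound: put all but a mass \<open>\<Theta>(\<epsilon>\<^sup>2)\<close> on one point. With probability
  \<open>(1 - 9\<epsilon>\<^sup>2)\<^sup>n\<close> only that point is sampled, and the truth cannot be told from the point mass; this
  forces \<open>n \<ge> c ln (1/\<delta>) / \<epsilon>\<^sup>2\<close>. Hiding one bit in each of about \<open>k/2\<close> pairs of rare points forces
  \<open>n \<ge> c k / \<epsilon>\<^sup>2\<close>, by averaging over all bit strings (Assouad): the bit of an unseen pair is guessed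
  wrong half of the time, whereas an \<open>\<epsilon>\<close>-accurate estimate gets most bits right.
\<close>

section \<open>Binomial likelihood ratios\<close>

text \<open>Discrete form of integrating \<open>1 / sqrt T\<close> to \<open>2 * sqrt T\<close>:
  with \<open>b m = v\<^sup>2 - u\<^sup>2\<close> the new term is
  \<open>(v - u) * (v + u) / v\<close>, at most \<open>2 * (v - u)\<close>, and this telescopes. If
  \<open>v = 0\<close>, the term is \<open>0\<close> by the convention for division.\<close>

lemma sum_div_sqrt_partial_sums_le:
  fixes b :: "nat \<Rightarrow> real"
  assumes "\<And>j. b j \<ge> 0"
  shows "(\<Sum>j<m. b j / sqrt (\<Sum>i\<le>j. b i)) \<le> 2 * sqrt (\<Sum>i<m. b i)"
proof (induction m)
  case (Suc m)
  define T where "T = (\<Sum>i<m. b i)"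
  define u v where "u = sqrt T" and "v = sqrt (T + b m)"
  have T: "T \<ge> 0" unfolding T_def using assms by (intro sum_nonneg) auto
  have uv: "0 \<le> u" "u \<le> v" "u\<^sup>2 = T" "v\<^sup>2 = T + b m"
    using T assms[of m] by (auto simp: u_def v_def)
  have "b m / v \<le> 2 * v - 2 * u"
  proof (cases "v = 0")
    case False
    then have "v > 0" using uv by linarith
    have "b m = (v - u) * (v + u)" using uv by (simp add: power2_eq_square algebra_simps)
    also have "\<dots> \<le> (v - u) * (2 * v)" using uv by (intro mult_left_mono) auto
    finally show ?thesis using \<open>v > 0\<close> by (simp add: field_simps)
  qed (use uv in auto)
  then show ?case
    using Suc.IH by (simp add: lessThan_Suc_atMost[symmetric] T_def u_def v_def)
qed auto

text \<open>Chernoff's bound by change of measure, cross-multiplied so that \<open>0\<close> and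
  \<open>1\<close> are allowed as parameters: for \<open>r \<le> p\<close> the likelihood ratio of
  \<open>p\<close> to \<open>r\<close> grows with the count, so up to \<open>j\<close> it is at most
  its value at \<open>j\<close>, and the binomial probabilities for \<open>r\<close> sum to
  \<open>1\<close>.\<close>

lemma binomial_tail_product_le:
  fixes p r :: real
  assumes r: "0 \<le> r" "r \<le> p" and p: "p \<le> 1" and j: "j \<le> n"
  shows "(\<Sum>i\<le>j. real (n choose i) * (p ^ i * (1 - p) ^ (n - i))) * (r ^ j * (1 - r) ^ (n - j))
    \<le> p ^ j * (1 - p) ^ (n - j)"
proof -
  have term_le: "p ^ i * (1 - p) ^ (n - i) * (r ^ j * (1 - r) ^ (n - j))
      \<le> p ^ j * (1 - p) ^ (n - j) * (r ^ i * (1 - r) ^ (n - i))" if i: "i \<le> j" for i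
  proof -
    have e: "x ^ j = x ^ i * x ^ (j - i)" "x ^ (n - i) = x ^ (n - j) * x ^ (j - i)" for x :: real
      using i j by (simp_all flip: power_add)
    have "((1 - p) * r) ^ (j - i) \<le> (p * (1 - r)) ^ (j - i)"
    proof (rule power_mono)
      show "(1 - p) * r \<le> p * (1 - r)" using r by (simp add: algebra_simps)
    qed (use r p in auto)
    then have "p ^ i * (1 - p) ^ (n - j) * r ^ i * (1 - r) ^ (n - j) * ((1 - p) * r) ^ (j - i)
      \<le> p ^ i * (1 - p) ^ (n - j) * r ^ i * (1 - r) ^ (n - j) * (p * (1 - r)) ^ (j - i)"
      using r p by (intro mult_left_mono) auto
    then show ?thesis by (simp add: e power_mult_distrib mult_ac)
  qed
  have "(\<Sum>i\<le>j. real (n choose i) * (p ^ i * (1 - p) ^ (n - i))) * (r ^ j * (1 - r) ^ (n - j))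
    \<le> (\<Sum>i\<le>j. p ^ j * (1 - p) ^ (n - j) * (real (n choose i) * r ^ i * (1 - r) ^ (n - i)))"
    unfolding sum_distrib_right
  proof (intro sum_mono)
    fix i assume "i \<in> {..j}"
    then have "real (n choose i) * (p ^ i * (1 - p) ^ (n - i) * (r ^ j * (1 - r) ^ (n - j)))
      \<le> real (n choose i) * (p ^ j * (1 - p) ^ (n - j) * (r ^ i * (1 - r) ^ (n - i)))"
      by (intro mult_left_mono term_le) auto
    then show "real (n choose i) * (p ^ i * (1 - p) ^ (n - i)) * (r ^ j * (1 - r) ^ (n - j))
      \<le> p ^ j * (1 - p) ^ (n - j) * (real (n choose i) * r ^ i * (1 - r) ^ (n - i))"
      by (simp add: mult_ac)
  qed
  also have "\<dots> \<le> (\<Sum>i\<le>n. p ^ j * (1 - p) ^ (n - j) * (real (n choose i) * r ^ i * (1 - r) ^ (n - i)))"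
    using r p j by (intro sum_mono2) auto
  also have "\<dots> = p ^ j * (1 - p) ^ (n - j)"
    using binomial_ring[of r "1 - r" n] by (simp flip: sum_distrib_left)
  finally show ?thesis .
qed

text \<open>The summand is the probability of \<open>j\<close> times the square root of the
  likelihood ratio \<open>R j / w j\<close>. By the tail bound this ratio is at most
  \<open>1 / S j\<close>, and the sum telescopes.\<close>

lemma binomial_likelihood_ratio_half:
  fixes p :: real
  assumes p: "0 \<le> p" "p \<le> 1"
  shows "(\<Sum>j | j \<le> n \<and> real j \<le> real n * p. real (n choose j) *
      sqrt (p ^ j * (1 - p) ^ (n - j) * ((real j / real n) ^ j * (1 - real j / real n) ^ (n - j)))) \<le> 2"
proof -
  define w where "w j = p ^ j * (1 - p) ^ (n - j)" for j
  define R where "R j = (real j / real n) ^ j * (1 - real j / real n) ^ (n - j)" for j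
  \<comment> \<open>Cutting off at the mean turns the partial sums \<open>S\<close> into lower tail
    probabilities.\<close>
  define b where "b j = (if j \<le> n \<and> real j \<le> real n * p then real (n choose j) * w j else 0)" for j
  define S where "S j = (\<Sum>i\<le>j. b i)" for j
  have w0: "w j \<ge> 0" for j using p by (simp add: w_def)
  have b0: "b j \<ge> 0" for j using w0 by (simp add: b_def)
  have term_le: "real (n choose j) * sqrt (w j * R j) \<le> b j / sqrt (S j)"
    if j: "j \<le> n" "real j \<le> real n * p" for j
  proof (cases "w j = 0")
    case True
    then show ?thesis using b0 by (simp add: S_def sum_nonneg)
  next
    case False
    then have w: "w j > 0" using w0[of j] by linarith
    have bj: "b j = real (n choose j) * w j" using j by (simp add: b_def)
    have "0 < b j" using w j bj by (simp add: zero_less_binomial_iff)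
    also have "b j \<le> S j" unfolding S_def using b0 by (intro member_le_sum) auto
    finally have S: "S j > 0" .
    have r: "0 \<le> real j / real n" "real j / real n \<le> p" "real j / real n \<le> 1"
      using j p by (auto simp: field_simps divide_le_eq)
    have "S j \<le> (\<Sum>i\<le>j. real (n choose i) * w i)"
      unfolding S_def using w0 by (intro sum_mono) (auto simp: b_def)
    then have "S j * R j \<le> (\<Sum>i\<le>j. real (n choose i) * w i) * R j"
      using r by (intro mult_right_mono) (auto simp: R_def)
    \<comment> \<open>The tail bound is used at the empirical frequency \<open>r = j / n\<close>,
      which is at most \<open>p\<close> because \<open>j\<close> lies in the lower tail.\<close>
    also have "\<dots> \<le> w j"
      unfolding R_def w_def by (rule binomial_tail_product_le) (use r p j in auto)
    finally have "sqrt (w j * R j) * sqrt (S j) \<le> sqrt (w j * w j)"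
      unfolding real_sqrt_mult[symmetric] using w by (intro real_sqrt_le_mono) (simp add: mult_ac)
    then have "sqrt (w j * R j) \<le> w j / sqrt (S j)"
      using w S by (simp add: field_simps)
    then show ?thesis
      unfolding bj using mult_left_mono[of _ _ "real (n choose j)"] by fastforce
  qed
  have "(\<Sum>j | j \<le> n \<and> real j \<le> real n * p. real (n choose j) * sqrt (w j * R j))
    \<le> (\<Sum>j | j \<le> n \<and> real j \<le> real n * p. b j / sqrt (S j))"
    by (intro sum_mono term_le) auto
  also have "\<dots> \<le> (\<Sum>j<Suc n. b j / sqrt (S j))"
    using b0 by (intro sum_mono2) (auto simp: S_def sum_nonneg)
  also have "\<dots> \<le> 2 * sqrt (\<Sum>j<Suc n. b j)"
    unfolding S_def by (rule sum_div_sqrt_partial_sums_le) (rule b0)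
  also have "(\<Sum>j<Suc n. b j) \<le> (\<Sum>j\<le>n. real (n choose j) * w j)"
    unfolding lessThan_Suc_atMost using w0 by (intro sum_mono) (auto simp: b_def)
  also have "\<dots> = 1"
    using binomial_ring[of p "1 - p" n] by (simp add: w_def mult.assoc)
  finally show ?thesis by (simp add: w_def R_def)
qed

text \<open>Replacing \<open>j\<close> by \<open>n - j\<close> and \<open>p\<close> by
  \<open>1 - p\<close> reflects the upper tail to the lower one, so each contributes at most
  \<open>2\<close>; a count equal to the mean is in both.\<close>

lemma binomial_likelihood_ratio:
  fixes p :: real
  assumes p: "0 \<le> p" "p \<le> 1"
  shows "(\<Sum>j\<le>n. real (n choose j) *
      sqrt (p ^ j * (1 - p) ^ (n - j) * ((real j / real n) ^ j * (1 - real j / real n) ^ (n - j)))) \<le> 4"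
    (is "sum ?f _ \<le> 4")
proof -
  have f0: "?f j \<ge> 0" if "j \<le> n" for j
    using p that by (auto intro!: mult_nonneg_nonneg zero_le_power simp: divide_le_eq)
  have "sum ?f {..n} \<le> sum ?f {j. j \<le> n \<and> real j \<le> real n * p} + sum ?f {j. j \<le> n \<and> real n * p \<le> real j}"
  proof -
    have "{..n} = {j. j \<le> n \<and> real j \<le> real n * p} \<union> {j. j \<le> n \<and> real n * p \<le> real j}" by auto
    then have "sum ?f {..n} = sum ?f ({j. j \<le> n \<and> real j \<le> real n * p} \<union> {j. j \<le> n \<and> real n * p \<le> real j})"
      by (rule arg_cong)
    also have "\<dots> \<le> sum ?f {j. j \<le> n \<and> real j \<le> real n * p} + sum ?f {j. j \<le> n \<and> real n * p \<le> real j}"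
      by (subst sum_Un) (auto intro!: sum_nonneg f0)
    finally show ?thesis .
  qed
  also have "sum ?f {j. j \<le> n \<and> real j \<le> real n * p} \<le> 2"
    by (rule binomial_likelihood_ratio_half[OF p])
  also have "sum ?f {j. j \<le> n \<and> real n * p \<le> real j} =
      (\<Sum>j | j \<le> n \<and> real j \<le> real n * (1 - p). real (n choose j) *
      sqrt ((1 - p) ^ j * (1 - (1 - p)) ^ (n - j) * ((real j / real n) ^ j * (1 - real j / real n) ^ (n - j))))"
  proof (rule sum.reindex_bij_witness[of _ "\<lambda>j. n - j" "\<lambda>j. n - j"])
    fix j assume "j \<in> {j. j \<le> n \<and> real n * p \<le> real j}"
    then have j: "j \<le> n" by auto
    have e: "1 - real (n - j) / real n = real j / real n" "real (n - j) / real n = 1 - real j / real n" if "n > 0"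
      using j that by (simp_all add: of_nat_diff diff_divide_distrib)
    show "real (n choose (n - j)) * sqrt ((1 - p) ^ (n - j) * (1 - (1 - p)) ^ (n - (n - j)) *
        ((real (n - j) / real n) ^ (n - j) * (1 - real (n - j) / real n) ^ (n - (n - j)))) = ?f j"
    proof (cases "n = 0")
      case False
      then have n: "n > 0" by simp
      show ?thesis unfolding e(1)[OF n] unfolding e(2)[OF n]
        using j by (simp add: binomial_symmetric[of j n] mult_ac)
    qed (use j in simp)
  qed (auto simp: of_nat_diff algebra_simps)
  also have "\<dots> \<le> 2" by (rule binomial_likelihood_ratio_half) (use p in auto)
  finally show ?thesis by simp
qed

text \<open>Homogeneous form of the preceding bound, by normalising with \<open>s = p + q\<close>
  and \<open>n\<close>. It is meant for \<open>p\<close> the mass of the letter peeled off and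
  \<open>q\<close> the mass of the letters that remain.\<close>

lemma binomial_sqrt_sum_le:
  fixes p q :: real
  assumes "0 \<le> p" "0 \<le> q"
  shows "(\<Sum>j\<le>n. real (n choose j) * (sqrt ((p * real j) ^ j) * sqrt ((q * real (n - j)) ^ (n - j))))
    \<le> 4 * sqrt (((p + q) * real n) ^ n)"
proof (cases "n = 0 \<or> p + q = 0")
  case True
  show ?thesis
  proof (cases "n = 0")
    case False
    then have "p = 0" "q = 0" using True assms by linarith+
    \<comment> \<open>As \<open>n > 0\<close>, at least one of the two exponents is positive, and
      its base is \<open>0\<close>.\<close>
    then have "sqrt ((p * real j) ^ j) * sqrt ((q * real (n - j)) ^ (n - j)) = 0" if "j \<le> n" for j
      using that False by (cases "j = 0") (auto simp: power_0_left)
    then have "(\<Sum>j\<le>n. real (n choose j) * (sqrt ((p * real j) ^ j) * sqrt ((q * real (n - j)) ^ (n - j)))) = 0"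
      by (intro sum.neutral ballI) (simp only: mult_zero_right atMost_iff)
    then show ?thesis using assms by simp
  qed simp
next
  case False
  define s where "s = p + q"
  have s: "s > 0" and n: "n > 0" using False assms by (auto simp: s_def)
  have ps: "0 \<le> p / s" "p / s \<le> 1" "1 - p / s = q / s"
    using assms s by (auto simp: s_def field_simps)
  have "real (n choose j) * (sqrt ((p * real j) ^ j) * sqrt ((q * real (n - j)) ^ (n - j))) =
     sqrt ((s * real n) ^ n) * (real (n choose j) * sqrt ((p / s) ^ j * (1 - p / s) ^ (n - j) *
         ((real j / real n) ^ j * (1 - real j / real n) ^ (n - j))))" if j: "j \<le> n" for j
  proof -
    have e: "1 - real j / real n = real (n - j) / real n" using n j by (simp add: field_simps of_nat_diff)
    have "(p * real j) ^ j * (q * real (n - j)) ^ (n - j) =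
      ((s * real n) ^ j * (s * real n) ^ (n - j)) *
       ((p / s) ^ j * (q / s) ^ (n - j) * ((real j / real n) ^ j * (real (n - j) / real n) ^ (n - j)))"
      using s n by (simp add: power_mult_distrib power_divide field_simps)
    also have "(s * real n) ^ j * (s * real n) ^ (n - j) = (s * real n) ^ n"
      using j by (simp flip: power_add)
    finally have "sqrt ((p * real j) ^ j) * sqrt ((q * real (n - j)) ^ (n - j)) =
      sqrt ((s * real n) ^ n) *
       sqrt ((p / s) ^ j * (q / s) ^ (n - j) * ((real j / real n) ^ j * (real (n - j) / real n) ^ (n - j)))"
      by (simp only: flip: real_sqrt_mult)
    then show ?thesis unfolding e ps(3) by (simp only: mult.left_commute)
  qed
  then have "(\<Sum>j\<le>n. real (n choose j) * (sqrt ((p * real j) ^ j) * sqrt ((q * real (n - j)) ^ (n - j)))) =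
    sqrt ((s * real n) ^ n) * (\<Sum>j\<le>n. real (n choose j) * sqrt ((p / s) ^ j * (1 - p / s) ^ (n - j) *
         ((real j / real n) ^ j * (1 - real j / real n) ^ (n - j))))"
    unfolding sum_distrib_left by (intro sum.cong refl) (simp only: atMost_iff)
  also have "\<dots> \<le> sqrt ((s * real n) ^ n) * 4"
    using s by (intro mult_left_mono binomial_likelihood_ratio ps) auto
  finally show ?thesis by (simp add: s_def mult_ac)
qed

section \<open>Multinomial sums\<close>

text \<open>For finite \<open>S\<close> this sums, over all words of length \<open>n\<close> in
  \<open>S\<close>, the product of the letter weights times the product of the \<open>f i\<close> at
  the letter counts. Removing the first letter shifts its \<open>f\<close>. The weights need not sum
  to \<open>1\<close>, so letters can be taken out of \<open>S\<close>.\<close>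

primrec multinomial_sum ::
  "'a set \<Rightarrow> ('a \<Rightarrow> real) \<Rightarrow> nat \<Rightarrow> ('a \<Rightarrow> nat \<Rightarrow> real) \<Rightarrow> real" where
  "multinomial_sum S p 0 f = (\<Prod>i\<in>S. f i 0)"
| "multinomial_sum S p (Suc n) f =
     (\<Sum>x\<in>S. p x * multinomial_sum S p n (f(x := \<lambda>j. f x (Suc j))))"

lemma multinomial_sum_cong:
  assumes "\<And>i. i \<in> S \<Longrightarrow> f i = g i"
  shows "multinomial_sum S p n f = multinomial_sum S p n g"
  using assms
proof (induction n arbitrary: f g)
  case (Suc n)
  show ?case unfolding multinomial_sum.simps
    by (intro sum.cong refl arg_cong2[of _ _ _ _ "(*)"] Suc.IH) (use Suc.prems in auto)
qed auto

text \<open>Words are sorted by the number \<open>j\<close> of occurrences of \<open>a\<close>,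
  whose positions the binomial coefficient chooses. The induction splits off the first letter, and
  Pascal's rule merges the two cases.\<close>

lemma multinomial_sum_insert:
  assumes "finite S" "a \<notin> S"
  shows "multinomial_sum (insert a S) p n f =
    (\<Sum>j\<le>n. real (n choose j) * p a ^ j * f a j * multinomial_sum S p (n - j) f)"
proof (induction n arbitrary: f)
  case 0
  show ?case using assms by simp
next
  case (Suc n)
  define M where "M = multinomial_sum S p"
  have restrict: "M k (f(a := h)) = M k f" for k h
    unfolding M_def by (rule multinomial_sum_cong) (use assms in auto)
  \<comment> \<open>Either the first letter is \<open>a\<close>, which shifts \<open>f a\<close>
    only, or it lies in \<open>S\<close> and leaves \<open>f a\<close> alone.\<close>
  have "multinomial_sum (insert a S) p (Suc n) f =
    p a * (\<Sum>j\<le>n. real (n choose j) * p a ^ j * f a (Suc j) * M (n - j) f) +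
    (\<Sum>x\<in>S. p x * (\<Sum>j\<le>n. real (n choose j) * p a ^ j * f a j * M (n - j) (f(x := \<lambda>j. f x (Suc j)))))"
  proof -
    have "(f(x := h)) a = f a" if "x \<in> S" for x h using assms that by auto
    then show ?thesis
      using assms
      by (simp add: Suc.IH restrict del: fun_upd_apply flip: M_def) simp
  qed
  also have "(\<Sum>x\<in>S. p x * (\<Sum>j\<le>n. real (n choose j) * p a ^ j * f a j * M (n - j) (f(x := \<lambda>j. f x (Suc j)))))
    = (\<Sum>j\<le>n. real (n choose j) * p a ^ j * f a j * M (Suc n - j) f)"
  proof -
    have "(\<Sum>x\<in>S. p x * (\<Sum>j\<le>n. real (n choose j) * p a ^ j * f a j * M (n - j) (f(x := \<lambda>j. f x (Suc j)))))
     = (\<Sum>j\<le>n. \<Sum>x\<in>S. p x * (real (n choose j) * p a ^ j * f a j * M (n - j) (f(x := \<lambda>j. f x (Suc j)))))"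
      unfolding sum_distrib_left by (rule sum.swap)
    also have "\<dots> = (\<Sum>j\<le>n. real (n choose j) * p a ^ j * f a j * M (Suc n - j) f)"
      by (intro sum.cong refl) (auto simp: Suc_diff_le M_def sum_distrib_left mult_ac intro!: sum.cong)
    finally show ?thesis .
  qed
  also have "p a * (\<Sum>j\<le>n. real (n choose j) * p a ^ j * f a (Suc j) * M (n - j) f) =
     (\<Sum>j\<le>n. real (n choose j) * p a ^ Suc j * f a (Suc j) * M (Suc n - Suc j) f)"
    by (simp add: sum_distrib_left mult_ac)
  also have "(\<Sum>j\<le>n. real (n choose j) * p a ^ Suc j * f a (Suc j) * M (Suc n - Suc j) f) +
      (\<Sum>j\<le>n. real (n choose j) * p a ^ j * f a j * M (Suc n - j) f) =
      (\<Sum>j\<le>Suc n. real (Suc n choose j) * p a ^ j * f a j * M (Suc n - j) f)"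
  proof -
    define g where "g j = p a ^ j * f a j * M (Suc n - j) f" for j
    have "(\<Sum>j\<le>n. real (n choose j) * g j) = (\<Sum>j\<le>Suc n. real (n choose j) * g j)"
      by simp
    also have "\<dots> = g 0 + (\<Sum>j\<le>n. real (n choose Suc j) * g (Suc j))"
      by (subst sum.atMost_Suc_shift) simp
    finally have "(\<Sum>j\<le>n. real (n choose j) * g (Suc j)) + (\<Sum>j\<le>n. real (n choose j) * g j) =
       g 0 + (\<Sum>j\<le>n. real (Suc n choose Suc j) * g (Suc j))"
      by (simp add: algebra_simps sum.distrib)
    also have "\<dots> = (\<Sum>j\<le>Suc n. real (Suc n choose j) * g j)"
      by (subst sum.atMost_Suc_shift) simp
    finally show ?thesis by (simp only: g_def mult.assoc)
  qed
  finally show ?case by (simp only: M_def)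
qed

text \<open>Up to a factor \<open>sqrt (n ^ n)\<close>, the product of these functions at the counts
  is the square root of the likelihood ratio between empirical and true distribution. In the
  induction \<open>S\<close> acts as one letter of weight \<open>sum p S\<close>, and each insertion
  costs a factor \<open>4\<close>.\<close>

lemma multinomial_sum_sqrt_le:
  fixes p :: "'a \<Rightarrow> real"
  assumes "finite S" "\<And>i. i \<in> S \<Longrightarrow> p i \<ge> 0"
  shows "multinomial_sum S p n (\<lambda>i j. sqrt ((real j / p i) ^ j))
    \<le> 4 ^ card S * sqrt ((sum p S * real n) ^ n)"
  using assms
proof (induction S arbitrary: n rule: finite_induct)
  case empty
  then show ?case by (cases n) auto
next
  case (insert a S)
  let ?f = "\<lambda>i j. sqrt ((real j / p i) ^ j)"
  have pa: "p a \<ge> 0" and P: "sum p S \<ge> 0" using insert.prems by (auto intro: sum_nonneg)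
  \<comment> \<open>This includes \<open>p a = 0\<close>, where both sides are \<open>1\<close> for
    \<open>j = 0\<close> and \<open>0\<close> otherwise.\<close>
  have coeff: "p a ^ j * ?f a j = sqrt ((p a * real j) ^ j)" for j
  proof (cases "p a = 0")
    case False
    then have "p a ^ j * p a ^ j * (real j / p a) ^ j = (p a * real j) ^ j"
      by (simp flip: power_mult_distrib)
    moreover have "p a ^ j = sqrt (p a ^ j * p a ^ j)" using pa by simp
    ultimately show ?thesis by (metis real_sqrt_mult)
  qed (cases j; simp)
  have "multinomial_sum (insert a S) p n ?f =
    (\<Sum>j\<le>n. real (n choose j) * (p a ^ j * ?f a j) * multinomial_sum S p (n - j) ?f)"
    using insert.hyps by (simp add: multinomial_sum_insert mult.assoc)
  also have "\<dots> \<le> (\<Sum>j\<le>n. real (n choose j) * sqrt ((p a * real j) ^ j) *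
      (4 ^ card S * sqrt ((sum p S * real (n - j)) ^ (n - j))))"
    unfolding coeff using pa insert.prems by (intro sum_mono mult_left_mono insert.IH) auto
  also have "\<dots> = 4 ^ card S * (\<Sum>j\<le>n. real (n choose j) *
      (sqrt ((p a * real j) ^ j) * sqrt ((sum p S * real (n - j)) ^ (n - j))))"
    by (simp add: sum_distrib_left mult_ac)
  also have "\<dots> \<le> 4 ^ card S * (4 * sqrt (((p a + sum p S) * real n) ^ n))"
    using pa P by (intro mult_left_mono binomial_sqrt_sum_le) auto
  finally show ?case using insert.hyps by simp
qed

section \<open>Expectations over i.i.d. samples\<close>

lemma finite_set_replicate_pmf:
  assumes "finite (set_pmf p)"
  shows "finite (set_pmf (replicate_pmf n p))"
  using finite_lists_length_eq[OF assms, of n]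
  by (simp add: set_replicate_pmf lists_eq_set Collect_conj_eq Int_commute)

text \<open>Summing over a superset \<open>S\<close> of the support allows two distributions to be
  expanded over the same index set.\<close>

lemma expectation_replicate_pmf_Suc:
  fixes F :: "'a list \<Rightarrow> real"
  assumes "finite S" "set_pmf p \<subseteq> S"
  shows "measure_pmf.expectation (replicate_pmf (Suc n) p) F =
    (\<Sum>x\<in>S. pmf p x * measure_pmf.expectation (replicate_pmf n p) (\<lambda>xs. F (x # xs)))"
proof -
  have fin: "finite (set_pmf (replicate_pmf n p))"
    using assms finite_subset by (intro finite_set_replicate_pmf) blast
  have "replicate_pmf (Suc n) p = p \<bind> (\<lambda>x. map_pmf ((#) x) (replicate_pmf n p))"
    by (simp add: map_pmf_def)
  then show ?thesis
    using assms fin by (simp add: pmf_expectation_bind[where A = S])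
qed

lemma expectation_prod_counts:
  fixes f :: "'a \<Rightarrow> nat \<Rightarrow> real"
  assumes "finite S" "set_pmf p \<subseteq> S"
  shows "measure_pmf.expectation (replicate_pmf n p) (\<lambda>xs. \<Prod>i\<in>S. f i (count (mset xs) i)) =
    multinomial_sum S (pmf p) n f"
proof (induction n arbitrary: f)
  case (Suc n)
  have "(\<Prod>i\<in>S. f i (count (mset (x # xs)) i)) =
      (\<Prod>i\<in>S. (f(x := \<lambda>j. f x (Suc j))) i (count (mset xs) i))" for x xs
    by (intro prod.cong) auto
  then show ?case
    by (simp only: expectation_replicate_pmf_Suc[OF assms] Suc.IH multinomial_sum.simps)
qed simp

section \<open>The empirical distribution\<close>

lemma hellinger_dist_sq_eq_half_sum:
  "(hellinger_dist k p q)\<^sup>2 = (\<Sum>i=1..k. (sqrt (pmf p i) - sqrt (pmf q i))\<^sup>2) / 2"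
proof -
  have "(\<Sum>i=1..k. (sqrt (pmf p i) - sqrt (pmf q i))\<^sup>2) \<ge> 0" by (intro sum_nonneg) auto
  then show ?thesis by (simp add: hellinger_dist_def power_mult_distrib power_divide)
qed

lemma hellinger_dist_sq:
  assumes "p \<in> distributions k" "q \<in> distributions k"
  shows "(hellinger_dist k p q)\<^sup>2 = 1 - (\<Sum>i=1..k. sqrt (pmf p i * pmf q i))"
proof -
  have "(\<Sum>i=1..k. pmf p i) = 1" "(\<Sum>i=1..k. pmf q i) = 1"
    using assms by (auto simp: distributions_def intro!: sum_pmf_eq_1)
  moreover have "(sqrt (pmf p i) - sqrt (pmf q i))\<^sup>2 = pmf p i + pmf q i - 2 * sqrt (pmf p i * pmf q i)" for i
    by (simp add: power2_diff real_sqrt_mult)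
  ultimately have "(\<Sum>i=1..k. (sqrt (pmf p i) - sqrt (pmf q i))\<^sup>2) =
      2 - 2 * (\<Sum>i=1..k. sqrt (pmf p i * pmf q i))"
    by (simp add: sum_subtractf sum.distrib sum_distrib_left)
  then show ?thesis by (simp add: hellinger_dist_sq_eq_half_sum)
qed

lemma hellinger_dist_nonneg: "hellinger_dist k p q \<ge> 0"
  unfolding hellinger_dist_def by (intro mult_nonneg_nonneg real_sqrt_ge_zero sum_nonneg) auto

lemma space_distributions_borel [simp]: "space (distributions_borel k) = distributions k"
  by (simp add: distributions_borel_def)

text \<open>Here \<open>a\<close> stands for an expected and \<open>N\<close> for an observed count.
  With \<open>u = sqrt (a / N)\<close> the exponent is \<open>N * (1 - u)\<close>, and
  \<open>u \<le> exp (u - 1)\<close> gives the bound.\<close>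

lemma exp_diff_sqrt_le:
  fixes a :: real
  assumes "a \<ge> 0" "N > 0 \<Longrightarrow> a > 0"
  shows "exp (real N - sqrt (a * real N)) \<le> sqrt ((real N / a) ^ N)"
proof (cases "N = 0")
  case False
  then have N: "N > 0" and a: "a > 0" using assms by auto
  define u where "u = sqrt (a / real N)"
  have u: "u > 0" using N a by (simp add: u_def)
  have "sqrt (a * real N) = sqrt (a / real N * (real N)\<^sup>2)" using N by (simp add: power2_eq_square)
  also have "\<dots> = u * real N" unfolding real_sqrt_mult u_def by simp
  finally have "exp (real N - sqrt (a * real N)) = exp (1 - u) ^ N"
    by (simp add: algebra_simps flip: exp_of_nat_mult)
  also have "exp (1 - u) \<le> 1 / u"
  proof -
    have "u \<le> exp (u - 1)" using exp_ge_add_one_self[of "u - 1"] by simp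
    then have "u * exp (1 - u) \<le> exp (u - 1) * exp (1 - u)" by (intro mult_right_mono) auto
    then show ?thesis using u by (simp add: field_simps flip: exp_add)
  qed
  then have "exp (1 - u) ^ N \<le> (1 / u) ^ N" by (intro power_mono) auto
  also have "(1 / u) ^ N = sqrt ((real N / a) ^ N)"
    by (simp add: u_def real_sqrt_divide real_sqrt_power)
  finally show ?thesis .
qed simp

text \<open>As the counts sum to \<open>n\<close>, the exponent is the sum of
  \<open>N i - sqrt (n * pmf p i * N i)\<close>, so the exponential factors over the letters. Every
  observed letter has a positive expected count, since samples lie in the support.\<close>

lemma exp_hellinger_empirical_le:
  assumes p: "p \<in> distributions k" and xs: "set xs \<subseteq> set_pmf p" "xs \<noteq> []"
  defines "n \<equiv> length xs"
  shows "exp (real n * (hellinger_dist k p (pmf_of_multiset (mset xs)))\<^sup>2) \<le>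
    (\<Prod>i=1..k. sqrt ((real (count (mset xs) i) / pmf p i) ^ count (mset xs) i)) / sqrt (real n ^ n)"
proof -
  define q where "q = pmf_of_multiset (mset xs)"
  define N where "N i = count (mset xs) i" for i
  have n: "n > 0" using xs by (simp add: n_def)
  have pmf_q: "pmf q i = real (N i) / real n" for i
    using xs by (simp add: q_def N_def n_def)
  have q: "q \<in> distributions k"
    using p xs by (auto simp: q_def distributions_def)
  have "(\<Sum>i=1..k. pmf q i) = 1"
    using q by (auto simp: distributions_def intro!: sum_pmf_eq_1)
  then have sumN: "(\<Sum>i=1..k. real (N i)) = real n"
    using n by (simp add: pmf_q field_simps flip: sum_divide_distrib)
  then have sumN': "(\<Sum>i=1..k. N i) = n" by (metis of_nat_eq_iff of_nat_sum)
  have "real n * sqrt (pmf p i * pmf q i) = sqrt (real n * pmf p i * real (N i))" for i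
  proof -
    have "real n * pmf p i * real (N i) = (real n)\<^sup>2 * (pmf p i * pmf q i)"
      using n by (simp add: pmf_q power2_eq_square)
    then have "sqrt (real n * pmf p i * real (N i)) = sqrt ((real n)\<^sup>2 * (pmf p i * pmf q i))" by (rule arg_cong)
    also have "\<dots> = real n * sqrt (pmf p i * pmf q i)" unfolding real_sqrt_mult by simp
    finally show ?thesis by simp
  qed
  then have "real n * (hellinger_dist k p q)\<^sup>2 = (\<Sum>i=1..k. real (N i) - sqrt (real n * pmf p i * real (N i)))"
    using sumN by (simp add: hellinger_dist_sq[OF p q] right_diff_distrib sum_distrib_left sum_subtractf)
  then have "exp (real n * (hellinger_dist k p q)\<^sup>2) = (\<Prod>i=1..k. exp (real (N i) - sqrt (real n * pmf p i * real (N i))))"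
    by (simp add: exp_sum)
  also have "\<dots> \<le> (\<Prod>i=1..k. sqrt ((real (N i) / (real n * pmf p i)) ^ N i))"
  proof (intro prod_mono conjI exp_diff_sqrt_le)
    fix i assume "N i > 0"
    then have "i \<in> set_pmf p" using xs by (auto simp: N_def)
    then show "real n * pmf p i > 0" using n by (simp add: pmf_positive)
  qed auto
  also have "\<dots> = (\<Prod>i=1..k. sqrt ((real (N i) / pmf p i) ^ N i) / sqrt (real n ^ N i))"
    by (intro prod.cong refl) (simp add: power_divide power_mult_distrib real_sqrt_divide real_sqrt_mult)
  also have "\<dots> = (\<Prod>i=1..k. sqrt ((real (N i) / pmf p i) ^ N i)) / (\<Prod>i=1..k. sqrt (real n) ^ N i)"
    by (simp add: prod_dividef real_sqrt_power)
  also have "(\<Prod>i=1..k. sqrt (real n) ^ N i) = sqrt (real n ^ n)"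
    by (simp only: sumN' real_sqrt_power power_sum[symmetric])
  finally show ?thesis by (simp add: q_def N_def)
qed

text \<open>The expected product over the letters is a multinomial sum; its bound contains
  \<open>sqrt (n ^ n)\<close>, which cancels the denominator.\<close>

lemma expectation_exp_hellinger_empirical_le:
  assumes p: "p \<in> distributions k" and n: "n > 0"
  shows "measure_pmf.expectation (replicate_pmf n p)
     (\<lambda>xs. exp (real n * (hellinger_dist k p (pmf_of_multiset (mset xs)))\<^sup>2)) \<le> 4 ^ k"
proof -
  have pk: "set_pmf p \<subseteq> {1..k}" using p by (simp add: distributions_def)
  then have fin: "finite (set_pmf (replicate_pmf n p))"
    by (intro finite_set_replicate_pmf) (rule finite_subset, auto)
  let ?F = "\<lambda>xs. \<Prod>i=1..k. sqrt ((real (count (mset xs) i) / pmf p i) ^ count (mset xs) i)"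
  have "measure_pmf.expectation (replicate_pmf n p)
     (\<lambda>xs. exp (real n * (hellinger_dist k p (pmf_of_multiset (mset xs)))\<^sup>2))
    \<le> measure_pmf.expectation (replicate_pmf n p) (\<lambda>xs. ?F xs / sqrt (real n ^ n))"
  proof (intro integral_mono_AE integrable_measure_pmf_finite[OF fin])
    show "AE xs in measure_pmf (replicate_pmf n p).
      exp (real n * (hellinger_dist k p (pmf_of_multiset (mset xs)))\<^sup>2) \<le> ?F xs / sqrt (real n ^ n)"
    proof (rule AE_pmfI)
      fix xs assume "xs \<in> set_pmf (replicate_pmf n p)"
      then have "set xs \<subseteq> set_pmf p" "length xs = n" by (auto simp: set_replicate_pmf)
      then show "exp (real n * (hellinger_dist k p (pmf_of_multiset (mset xs)))\<^sup>2) \<le> ?F xs / sqrt (real n ^ n)"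
        using exp_hellinger_empirical_le[OF p, of xs] n by auto
    qed
  qed
  also have "\<dots> = multinomial_sum {1..k} (pmf p) n (\<lambda>i j. sqrt ((real j / pmf p i) ^ j)) / sqrt (real n ^ n)"
    using expectation_prod_counts[of "{1..k}" p n "\<lambda>i j. sqrt ((real j / pmf p i) ^ j)"] pk by simp
  also have "\<dots> \<le> 4 ^ card {1..k} * sqrt ((sum (pmf p) {1..k} * real n) ^ n) / sqrt (real n ^ n)"
    by (intro divide_right_mono multinomial_sum_sqrt_le) auto
  also have "\<dots> = 4 ^ k"
    using n pk by (simp add: sum_pmf_eq_1)
  finally show ?thesis .
qed

text \<open>Markov's inequality in integrated form: on the samples that occur, the indicator of
  success is at least \<open>1 - exp (n * (d\<^sup>2 - \<epsilon>\<^sup>2))\<close>. The estimator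
  is deterministic, hence a Dirac measure.\<close>

lemma success_prob_empirical_ge:
  assumes p: "p \<in> distributions k" and n: "n > 0" and \<epsilon>: "\<epsilon> > 0"
  shows "success_prob (hellinger_dist k) k n \<epsilon>
      (\<lambda>xs. return (distributions_borel k) (pmf_of_multiset (mset xs))) p \<ge> 1 - 4 ^ k * exp (- real n * \<epsilon>\<^sup>2)"
proof -
  have pk: "set_pmf p \<subseteq> {1..k}" using p by (simp add: distributions_def)
  then have fin: "finite (set_pmf (replicate_pmf n p))"
    by (intro finite_set_replicate_pmf) (rule finite_subset, auto)
  let ?d = "\<lambda>xs. hellinger_dist k p (pmf_of_multiset (mset xs))"
  have "1 - 4 ^ k * exp (- real n * \<epsilon>\<^sup>2) \<le>
    1 - measure_pmf.expectation (replicate_pmf n p) (\<lambda>xs. exp (real n * (?d xs)\<^sup>2)) * exp (- real n * \<epsilon>\<^sup>2)"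
    using expectation_exp_hellinger_empirical_le[OF p n] by simp
  also have "\<dots> = measure_pmf.expectation (replicate_pmf n p)
      (\<lambda>xs. 1 - exp (real n * (?d xs)\<^sup>2) * exp (- real n * \<epsilon>\<^sup>2))"
    by (subst Bochner_Integration.integral_diff) (auto intro!: integrable_measure_pmf_finite[OF fin])
  also have "\<dots> \<le> success_prob (hellinger_dist k) k n \<epsilon>
      (\<lambda>xs. return (distributions_borel k) (pmf_of_multiset (mset xs))) p"
    unfolding success_prob_def
  proof (intro integral_mono_AE integrable_measure_pmf_finite[OF fin] AE_pmfI)
    fix xs assume "xs \<in> set_pmf (replicate_pmf n p)"
    then have xs: "set xs \<subseteq> set_pmf p" "xs \<noteq> []" using n by (auto simp: set_replicate_pmf)
    then have q: "pmf_of_multiset (mset xs) \<in> distributions k"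
      using pk by (auto simp: distributions_def)
    have "1 - exp (real n * (?d xs)\<^sup>2) * exp (- real n * \<epsilon>\<^sup>2) \<le> 0" if "\<not> ?d xs \<le> \<epsilon>"
    proof -
      have "\<epsilon>\<^sup>2 \<le> (?d xs)\<^sup>2" using that \<epsilon> by (intro power_mono) auto
      then have "0 \<le> real n * (?d xs)\<^sup>2 + - real n * \<epsilon>\<^sup>2" by (simp add: mult_left_mono)
      then show ?thesis unfolding exp_add[symmetric] by simp
    qed
    then show "1 - exp (real n * (?d xs)\<^sup>2) * exp (- real n * \<epsilon>\<^sup>2) \<le>
      measure (return (distributions_borel k) (pmf_of_multiset (mset xs)))
        {q \<in> distributions k. hellinger_dist k p q \<le> \<epsilon>}"
      using q by (simp add: measure_return hellinger_ball_measurable indicator_def)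
  qed
  finally show ?thesis .
qed

section \<open>A sufficient sample size\<close>

lemma learnable_hellinger:
  assumes n: "n > 0" and \<epsilon>: "\<epsilon> > 0" and "4 ^ k * exp (- real n * \<epsilon>\<^sup>2) \<le> \<delta>"
  shows "learnable (hellinger_dist k) k \<epsilon> \<delta> n"
  unfolding learnable_def
proof (intro bexI[of _ "\<lambda>xs. return (distributions_borel k) (pmf_of_multiset (mset xs))"] ballI)
  fix p assume "p \<in> distributions k"
  from success_prob_empirical_ge[OF this n \<epsilon>] assms(3)
  show "1 - \<delta> \<le> success_prob (hellinger_dist k) k n \<epsilon>
      (\<lambda>xs. return (distributions_borel k) (pmf_of_multiset (mset xs))) p" by linarith
next
  have "return (distributions_borel k) (pmf_of_multiset (mset xs)) \<in> space (prob_algebra (distributions_borel k))"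
    if "length xs = n" "set xs \<subseteq> {1..k}" for xs
  proof -
    have "pmf_of_multiset (mset xs) \<in> distributions k"
      using that n by (auto simp: distributions_def)
    then show ?thesis by (simp add: space_prob_algebra prob_space_return)
  qed
  then show "(\<lambda>xs. return (distributions_borel k) (pmf_of_multiset (mset xs))) \<in> randomized_estimators k n"
    by (auto simp: randomized_estimators_def)
qed

lemma learnable_hellinger_upper:
  assumes k: "k > 0" and \<epsilon>: "0 < \<epsilon>" "\<epsilon> \<le> 1" and \<delta>: "0 < \<delta>" "\<delta> \<le> 1"
  obtains n where "learnable (hellinger_dist k) k \<epsilon> \<delta> n"
    and "real n \<le> 3 * ((real k + ln (1 / \<delta>)) / \<epsilon>\<^sup>2)"
proof -
  \<comment> \<open>The coefficient \<open>2\<close> of \<open>k\<close> absorbs the factor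
    \<open>4 ^ k\<close>, because \<open>4 \<le> exp 2\<close>.\<close>
  define g where "g = (2 * real k + ln (1 / \<delta>)) / \<epsilon>\<^sup>2"
  define n where "n = nat \<lceil>g\<rceil>"
  have L: "ln (1 / \<delta>) \<ge> 0" using \<delta> by simp
  have e2: "0 < \<epsilon>\<^sup>2" "\<epsilon>\<^sup>2 \<le> 1" using \<epsilon> by (auto simp: power_le_one)
  have g: "g > 0" using k L e2 by (auto simp: g_def intro!: divide_pos_pos)
  have n: "real n \<ge> g" "real n \<le> g + 1" using g by (auto simp: n_def of_nat_nat)
  have "real n * \<epsilon>\<^sup>2 \<ge> 2 * real k + ln (1 / \<delta>)"
    using n(1) e2 by (simp add: g_def pos_divide_le_eq)
  then have "exp (- real n * \<epsilon>\<^sup>2) \<le> exp (- real k * 2 - ln (1 / \<delta>))" by simp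
  also have "\<dots> = exp (- 2) ^ k * \<delta>"
    using \<delta> by (simp add: exp_diff ln_div mult.commute exp_minus field_simps flip: exp_of_nat_mult)
  finally have "4 ^ k * exp (- real n * \<epsilon>\<^sup>2) \<le> (4 * exp (- 2)) ^ k * \<delta>"
    by (simp add: power_mult_distrib mult.assoc)
  also have "\<dots> \<le> \<delta>"
  proof -
    have "(2::real) ^ 2 \<le> exp 1 ^ 2" using exp_ge_add_one_self[of 1] by (intro power_mono) auto
    also have "exp 1 ^ 2 = exp (2::real)" by (simp flip: exp_of_nat_mult)
    finally have "4 * exp (- 2 :: real) \<le> 1" by (simp add: exp_minus field_simps)
    then show ?thesis using \<delta> by (intro mult_left_le_one_le power_le_one) auto
  qed
  finally have "learnable (hellinger_dist k) k \<epsilon> \<delta> n"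
    using n g \<epsilon> by (intro learnable_hellinger) auto
  moreover have "real n \<le> 3 * ((real k + ln (1 / \<delta>)) / \<epsilon>\<^sup>2)"
  proof -
    \<comment> \<open>Rounding up costs at most \<open>1\<close>, and \<open>1 \<le> K\<close> since
      \<open>k \<ge> 1\<close> and \<open>\<epsilon> \<le> 1\<close>.\<close>
    define K L' where "K = real k / \<epsilon>\<^sup>2" and "L' = ln (1 / \<delta>) / \<epsilon>\<^sup>2"
    have "1 \<le> K" using k e2 by (simp add: K_def pos_le_divide_eq)
    moreover have "0 \<le> L'" using L e2 by (simp add: L'_def)
    moreover have "real n \<le> 2 * K + L' + 1" using n(2) by (simp add: g_def K_def L'_def add_divide_distrib)
    ultimately have "real n \<le> 3 * (K + L')" by argo
    then show ?thesis by (simp add: K_def L'_def add_divide_distrib)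
  qed
  ultimately show ?thesis using that by blast
qed

section \<open>Lower bounds\<close>

lemma pmf_replicate_pmf:
  assumes "length xs = n"
  shows "pmf (replicate_pmf n p) xs = prod_list (map (pmf p) xs)"
  using assms
proof (induction n arbitrary: xs)
  case (Suc n)
  then obtain y ys where xs: "xs = y # ys" "length ys = n" by (cases xs) auto
  have "replicate_pmf (Suc n) p = map_pmf (\<lambda>(x, xs). x # xs) (pair_pmf p (replicate_pmf n p))"
    by (simp add: pair_pmf_def map_pmf_def bind_assoc_pmf bind_return_pmf)
  moreover have "pmf \<dots> ((\<lambda>(x, xs). x # xs) (y, ys)) = pmf (pair_pmf p (replicate_pmf n p)) (y, ys)"
    by (rule pmf_map_inj') (auto simp: inj_on_def)
  ultimately show ?case using Suc.IH[OF xs(2)] xs(1) by (simp add: pmf_pair)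
qed simp

lemma replicate_pmf_return_pmf: "replicate_pmf n (return_pmf x) = return_pmf (replicate n x)"
  by (induction n) (auto simp: bind_return_pmf)

text \<open>Two-point bound, with \<open>F\<close> and \<open>G\<close> meant as error probabilities
  under \<open>P\<close> and \<open>Q\<close>. Samples staying in \<open>R\<close> are equally
  likely under both, and on them the errors add up to at least \<open>1\<close>; the left side is
  the probability of such samples.\<close>

lemma expectation_replicate_pmf_pair_ge:
  fixes F G :: "'a list \<Rightarrow> real"
  assumes fin: "finite R" "finite (set_pmf P)" "finite (set_pmf Q)"
    and eq: "\<And>x. x \<in> R \<Longrightarrow> pmf P x = pmf Q x"
    and "\<And>xs. 0 \<le> F xs" "\<And>xs. 0 \<le> G xs"
    and "\<And>xs. length xs = n \<Longrightarrow> set xs \<subseteq> R \<Longrightarrow> 1 \<le> F xs + G xs"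
  shows "(\<Sum>x\<in>R. pmf P x) ^ n \<le>
    measure_pmf.expectation (replicate_pmf n P) F + measure_pmf.expectation (replicate_pmf n Q) G"
  using assms(5-7)
proof (induction n arbitrary: F G)
  case (Suc n)
  define S where "S = R \<union> set_pmf P \<union> set_pmf Q"
  have S: "finite S" "set_pmf P \<subseteq> S" "set_pmf Q \<subseteq> S" "R \<subseteq> S" using fin by (auto simp: S_def)
  let ?F = "\<lambda>x. measure_pmf.expectation (replicate_pmf n P) (\<lambda>xs. F (x # xs))"
  let ?G = "\<lambda>x. measure_pmf.expectation (replicate_pmf n Q) (\<lambda>xs. G (x # xs))"
  have nonneg: "?F x \<ge> 0" "?G x \<ge> 0" for x using Suc.prems by auto
  have "(\<Sum>x\<in>R. pmf P x) ^ Suc n = (\<Sum>x\<in>R. pmf P x * (\<Sum>x\<in>R. pmf P x) ^ n)"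
    by (simp add: sum_distrib_right)
  also have "\<dots> \<le> (\<Sum>x\<in>R. pmf P x * (?F x + ?G x))"
    by (intro sum_mono mult_left_mono Suc.IH) (auto intro!: Suc.prems)
  also have "\<dots> = (\<Sum>x\<in>R. pmf P x * ?F x + pmf Q x * ?G x)"
    by (intro sum.cong refl) (simp add: eq distrib_left)
  also have "\<dots> \<le> (\<Sum>x\<in>S. pmf P x * ?F x + pmf Q x * ?G x)"
    using nonneg by (intro sum_mono2 S) auto
  finally show ?case
    by (simp only: expectation_replicate_pmf_Suc[OF S(1,2)] expectation_replicate_pmf_Suc[OF S(1,3)] sum.distrib)
qed simp

text \<open>Termwise this is \<open>(a + b - 2 * c)\<^sup>2 \<ge> 0\<close>; it stands in for the
  triangle inequality.\<close>

lemma hellinger_dist_sq_triangle: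
  "(hellinger_dist k p r)\<^sup>2 \<le> 2 * (hellinger_dist k p q)\<^sup>2 + 2 * (hellinger_dist k r q)\<^sup>2"
proof -
  have "(a - b)\<^sup>2 \<le> 2 * (a - c)\<^sup>2 + 2 * (b - c)\<^sup>2" for a b c :: real
    using zero_le_power2[of "a + b - 2 * c"] by (simp add: power2_eq_square algebra_simps)
  then have "(\<Sum>i=1..k. (sqrt (pmf p i) - sqrt (pmf r i))\<^sup>2) \<le>
     (\<Sum>i=1..k. 2 * (sqrt (pmf p i) - sqrt (pmf q i))\<^sup>2 + 2 * (sqrt (pmf r i) - sqrt (pmf q i))\<^sup>2)"
    by (intro sum_mono)
  then show ?thesis
    by (simp add: hellinger_dist_sq_eq_half_sum sum.distrib flip: sum_distrib_left)
qed

text \<open>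
  In the hard family all but a mass \<open>s\<close> sits on the single point \<open>1\<close>; the rest is split evenly
  over \<open>m\<close> pairs \<open>{2i + 2, 2i + 3}\<close>, and \<open>B\<close> decides which point of each pair is charged.
  A sample is informative with probability \<open>s\<close> only, which is where the factor \<open>1/\<epsilon>\<^sup>2\<close> comes from.
\<close>

definition hard_point :: "nat set \<Rightarrow> nat \<Rightarrow> nat" where
  "hard_point B i = (if i \<in> B then 2 * i + 2 else 2 * i + 3)"

definition hard_weight :: "real \<Rightarrow> nat \<Rightarrow> nat set \<Rightarrow> nat \<Rightarrow> real" where
  "hard_weight s m B j =
     (if j = 1 then 1 - s else if j \<in> hard_point B ` {..<m} then s / real m else 0)"

definition hard_pmf :: "real \<Rightarrow> nat \<Rightarrow> nat set \<Rightarrow> nat pmf" where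
  "hard_pmf s m B = embed_pmf (hard_weight s m B)"

lemma sum_hard_weight:
  assumes "m > 0" "finite S" "insert 1 (hard_point B ` {..<m}) \<subseteq> S"
  shows "sum (hard_weight s m B) S = 1"
proof -
  have inj: "inj_on (hard_point B) {..<m}"
    unfolding inj_on_def hard_point_def by (auto split: if_splits)
  have "sum (hard_weight s m B) S = sum (hard_weight s m B) (insert 1 (hard_point B ` {..<m}))"
    using assms by (intro sum.mono_neutral_right) (auto simp: hard_weight_def)
  also have "\<dots> = 1 - s + sum (hard_weight s m B) (hard_point B ` {..<m})"
    by (subst sum.insert) (auto simp: hard_weight_def hard_point_def)
  also have "sum (hard_weight s m B) (hard_point B ` {..<m}) = (\<Sum>i<m. s / real m)"
    by (subst sum.reindex[OF inj], intro sum.cong) (auto simp: hard_weight_def hard_point_def)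
  finally show ?thesis using assms by simp
qed

lemma pmf_hard_pmf:
  assumes "m > 0" "0 \<le> s" "s \<le> 1"
  shows "pmf (hard_pmf s m B) j = hard_weight s m B j"
  unfolding hard_pmf_def
proof (rule pmf_embed_pmf)
  show nonneg: "0 \<le> hard_weight s m B j" for j using assms by (simp add: hard_weight_def)
  let ?S = "insert 1 (hard_point B ` {..<m})"
  have "(\<integral>\<^sup>+j. ennreal (hard_weight s m B j) \<partial>count_space UNIV) = (\<Sum>j\<in>?S. ennreal (hard_weight s m B j))"
    by (rule nn_integral_count_space') (auto simp: hard_weight_def)
  also have "\<dots> = ennreal (sum (hard_weight s m B) ?S)"
    using nonneg by (intro sum_ennreal)
  also have "\<dots> = 1" using assms by (subst sum_hard_weight) auto
  finally show "(\<integral>\<^sup>+j. ennreal (hard_weight s m B j) \<partial>count_space UNIV) = 1" .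
qed

text \<open>The largest point that can be charged is
  \<open>2 * (m - 1) + 3 = 2 * m + 1\<close>.\<close>

lemma hard_pmf_in_distributions:
  assumes "m > 0" "0 \<le> s" "s \<le> 1" "2 * m + 1 \<le> k"
  shows "hard_pmf s m B \<in> distributions k"
  using assms(4) by (auto simp: distributions_def set_pmf_iff pmf_hard_pmf[OF assms(1-3)] hard_weight_def
      hard_point_def split: if_splits)

lemma prob_space_estimator:
  assumes "A \<in> randomized_estimators k n" "length xs = n" "set xs \<subseteq> {1..k}"
  shows "prob_space (A xs)" "sets (A xs) = sets (distributions_borel k)" "space (A xs) = distributions k"
proof -
  have "A xs \<in> space (prob_algebra (distributions_borel k))"
    using assms by (auto simp: randomized_estimators_def)
  then show "prob_space (A xs)" and *: "sets (A xs) = sets (distributions_borel k)"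
    by (auto simp: space_prob_algebra)
  show "space (A xs) = distributions k" using sets_eq_imp_space_eq[OF *] by simp
qed

text \<open>On the constant sample \<open>ys\<close>, the only one under \<open>p0\<close>, the
  estimate must be near \<open>p0\<close> with probability at least \<open>1 - \<delta>\<close>,
  hence far from \<open>p1\<close>. But \<open>ys\<close> also occurs under \<open>p1\<close>, with
  probability \<open>(1 - s) ^ n\<close>.\<close>

lemma learnable_hellinger_log_lower:
  assumes k: "k \<ge> 3" and \<epsilon>: "0 < \<epsilon>" "\<epsilon> \<le> 1/8" and \<delta>: "0 < \<delta>" "\<delta> \<le> 1/16"
    and "learnable (hellinger_dist k) k \<epsilon> \<delta> n"
  shows "ln (1 / \<delta>) / (36 * \<epsilon>\<^sup>2) \<le> real n"
proof -
  from assms(6) obtain A where A: "A \<in> randomized_estimators k n"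
    and success: "\<And>p. p \<in> distributions k \<Longrightarrow> success_prob (hellinger_dist k) k n \<epsilon> A p \<ge> 1 - \<delta>"
    by (auto simp: learnable_def)
  \<comment> \<open>The factor \<open>9\<close> makes the squared distance of \<open>p0\<close> and
    \<open>p1\<close> at least \<open>s / 2\<close>, which exceeds
    \<open>4 * \<epsilon>\<^sup>2\<close>; so the two success balls are disjoint.\<close>
  define s where "s = 9 * \<epsilon>\<^sup>2"
  have "\<epsilon>\<^sup>2 \<le> (1/8)\<^sup>2" using \<epsilon> by (intro power_mono) auto
  then have s: "0 < s" "s \<le> 1/2" using \<epsilon> by (auto simp: s_def power2_eq_square)
  define p0 where "p0 = return_pmf (1::nat)"
  define p1 where "p1 = hard_pmf s 1 {}"
  have p0: "p0 \<in> distributions k" using k by (simp add: p0_def distributions_def)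
  have p1: "p1 \<in> distributions k" using k s by (simp add: p1_def hard_pmf_in_distributions)
  have pmf1: "pmf p1 1 = 1 - s" using s by (simp add: p1_def pmf_hard_pmf hard_weight_def)
  define ball where "ball p = {q \<in> distributions k. hellinger_dist k p q \<le> \<epsilon>}" for p
  define ys where "ys = replicate n (1::nat)"
  have ys: "length ys = n" "set ys \<subseteq> {1..k}" using k by (auto simp: ys_def)
  interpret prob_space "A ys" by (rule prob_space_estimator[OF A ys])
  have meas: "ball p \<in> sets (A ys)" for p
    unfolding ball_def prob_space_estimator(2)[OF A ys] by (rule hellinger_ball_measurable)
  have "(hellinger_dist k p0 p1)\<^sup>2 = 1 - sqrt (1 - s)"
  proof -
    have "(\<Sum>i=1..k. sqrt (pmf p0 i * pmf p1 i)) = (\<Sum>i\<in>{1}. sqrt (pmf p0 i * pmf p1 i))"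
      using k by (intro sum.mono_neutral_right) (auto simp: p0_def)
    moreover have "pmf p0 1 = 1" by (simp add: p0_def)
    ultimately show ?thesis using pmf1 by (simp add: hellinger_dist_sq[OF p0 p1])
  qed
  also have "\<dots> \<ge> s / 2"
  proof -
    have "sqrt (1 - s) \<le> 1 - s / 2"
      using s by (intro real_le_lsqrt) (auto simp: power2_eq_square algebra_simps)
    then show ?thesis by simp
  qed
  finally have far: "(hellinger_dist k p0 p1)\<^sup>2 > 4 * \<epsilon>\<^sup>2" using \<epsilon>
    by (simp add: s_def) (smt (verit) zero_less_power)
  have disj: "ball p0 \<inter> ball p1 = {}"
  proof (rule ccontr)
    assume "ball p0 \<inter> ball p1 \<noteq> {}"
    then obtain q where "hellinger_dist k p0 q \<le> \<epsilon>" "hellinger_dist k p1 q \<le> \<epsilon>" by (auto simp: ball_def)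
    then have "(hellinger_dist k p0 q)\<^sup>2 \<le> \<epsilon>\<^sup>2" "(hellinger_dist k p1 q)\<^sup>2 \<le> \<epsilon>\<^sup>2"
      by (auto intro!: power_mono hellinger_dist_nonneg)
    then show False using hellinger_dist_sq_triangle[of k p0 p1 q] far by simp
  qed
  have "1 - \<delta> \<le> prob (ball p0)"
    using success[OF p0] by (simp add: success_prob_def p0_def replicate_pmf_return_pmf ball_def ys_def)
  moreover have "prob (ball p0) + prob (ball p1) \<le> 1"
    using finite_measure_Union[OF meas meas disj] prob_le_1[of "ball p0 \<union> ball p1"] by simp
  ultimately have ball1: "prob (ball p1) \<le> \<delta>" by simp
  have fin: "finite (set_pmf (replicate_pmf n p1))"
    using p1 by (intro finite_set_replicate_pmf) (auto simp: distributions_def intro: finite_subset)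
  \<comment> \<open>Success under \<open>p1\<close> has conditional probability at most
    \<open>\<delta>\<close> on \<open>ys\<close>, and at most \<open>1\<close> on any other
    sample.\<close>
  have "success_prob (hellinger_dist k) k n \<epsilon> A p1 \<le>
     measure_pmf.expectation (replicate_pmf n p1) (\<lambda>xs. 1 - (1 - \<delta>) * indicator {ys} xs)"
    unfolding success_prob_def
  proof (intro integral_mono_AE integrable_measure_pmf_finite[OF fin] AE_pmfI)
    fix xs assume "xs \<in> set_pmf (replicate_pmf n p1)"
    then have "length xs = n" "set xs \<subseteq> {1..k}" using p1 by (auto simp: set_replicate_pmf distributions_def)
    then interpret xs: prob_space "A xs" by (rule prob_space_estimator[OF A])
    show "xs.prob {q \<in> distributions k. hellinger_dist k p1 q \<le> \<epsilon>} \<le> 1 - (1 - \<delta>) * indicator {ys} xs"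
      using ball1 by (cases "xs = ys") (auto simp: ball_def)
  qed
  also have "\<dots> = 1 - (1 - \<delta>) * pmf (replicate_pmf n p1) ys"
    by (subst Bochner_Integration.integral_diff)
      (auto intro!: integrable_measure_pmf_finite[OF fin] simp: measure_pmf_single)
  also have "pmf (replicate_pmf n p1) ys = (1 - s) ^ n"
    using pmf1 by (simp add: pmf_replicate_pmf ys_def prod_list_replicate)
  finally have "(1 - \<delta>) * (1 - s) ^ n \<le> \<delta>" using success[OF p1] by simp
  moreover have "(1 / 2) * (1 - s) ^ n \<le> (1 - \<delta>) * (1 - s) ^ n"
    using \<delta> s by (intro mult_right_mono) auto
  ultimately have "(1 - s) ^ n \<le> 2 * \<delta>" by simp
  moreover have "exp (- 2 * s) ^ n \<le> (1 - s) ^ n"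
  proof (rule power_mono)
    have "1 \<le> (1 - s) * (1 + 2 * s)"
    proof -
      have "s * s \<le> s * (1 / 2)" using s by (intro mult_left_mono) auto
      then show ?thesis by (simp add: algebra_simps)
    qed
    also have "\<dots> \<le> (1 - s) * exp (2 * s)"
      using s exp_ge_add_one_self[of "2 * s"] by (intro mult_left_mono) auto
    finally show "exp (- 2 * s) \<le> 1 - s" by (simp add: exp_minus field_simps)
  qed auto
  ultimately have "exp (- 2 * s * real n) \<le> 2 * \<delta>"
    by (simp add: mult.commute flip: exp_of_nat_mult)
  \<comment> \<open>Squaring removes the factor \<open>2\<close>, as
    \<open>4 * \<delta>\<^sup>2 \<le> \<delta>\<close>. It doubles the exponent to
    \<open>4 * s * n\<close>, whence the constant \<open>36\<close>.\<close>
  then have "(exp (- 2 * s * real n))\<^sup>2 \<le> (2 * \<delta>)\<^sup>2" by (intro power_mono) auto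
  also have "\<dots> \<le> \<delta>" using \<delta> by (simp add: power2_eq_square)
  finally have "exp (- 4 * s * real n) \<le> \<delta>"
    by (simp add: power2_eq_square mult.assoc flip: exp_add)
  then have "- 4 * s * real n \<le> ln \<delta>" using \<delta> by (simp add: ln_ge_iff)
  then show ?thesis using \<delta> \<epsilon> by (simp add: ln_div s_def field_simps)
qed

section \<open>Lower bound in the alphabet size by Assouad's method\<close>

text \<open>
  The bit of the \<open>i\<close>-th pair is read off an estimate \<open>q\<close> by comparing its two masses;
  these are the estimates that get it wrong when the truth is \<open>hard_pmf s m B\<close>.
\<close>

definition wrong_bit :: "nat \<Rightarrow> nat set \<Rightarrow> nat \<Rightarrow> nat pmf set" where
  "wrong_bit k B i = {q \<in> distributions k. (i \<in> B) \<noteq> (pmf q (2 * i + 3) \<le> pmf q (2 * i + 2))}"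

lemma wrong_bit_measurable: "wrong_bit k B i \<in> sets (distributions_borel k)"
proof -
  have "{q \<in> space (distributions_borel k). (i \<in> B) \<noteq> (pmf q (2 * i + 3) \<le> pmf q (2 * i + 2))}
      \<in> sets (distributions_borel k)"
    by measurable
  then show ?thesis by (simp add: wrong_bit_def)
qed

lemma sum_pairs_le:
  fixes h :: "nat \<Rightarrow> real"
  assumes "2 * m + 1 \<le> k" "\<And>j. h j \<ge> 0"
  shows "(\<Sum>i<m. h (2 * i + 2) + h (2 * i + 3)) \<le> (\<Sum>j=1..k. h j)"
proof -
  have "(\<Sum>i<m. h (2 * i + 2) + h (2 * i + 3)) = (\<Sum>j=2..<2 * m + 2. h j)"
    by (induction m) (auto simp: numeral_eq_Suc)
  also have "\<dots> \<le> (\<Sum>j=1..k. h j)" using assms by (intro sum_mono2) auto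
  finally show ?thesis .
qed

text \<open>The true pair of square roots is \<open>a\<close> at the charged point and
  \<open>0\<close> at the other; \<open>v\<close> and \<open>u\<close> are the estimates there. In
  the wrong order the cheapest choice is \<open>u = v = a / 2\<close>.\<close>

lemma wrong_pair_cost:
  fixes a u v :: real
  assumes "0 \<le> v" "v \<le> u"
  shows "a\<^sup>2 / 2 \<le> u\<^sup>2 + (a - v)\<^sup>2"
proof -
  have "v\<^sup>2 \<le> u\<^sup>2" using assms by (intro power_mono)
  moreover have "a\<^sup>2 / 2 \<le> v\<^sup>2 + (a - v)\<^sup>2"
    using zero_le_power2[of "a - 2 * v"] by (simp add: power2_eq_square algebra_simps)
  ultimately show ?thesis by linarith
qed

text \<open>Each wrongly decoded pair adds at least \<open>a\<^sup>2 / 2 = s / (2 * m)\<close> to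
  the sum of squares, and the squared distance is half of that sum.\<close>

lemma wrong_bits_le_hellinger:
  assumes m: "m > 0" and s: "0 \<le> s" "s \<le> 1" and k: "2 * m + 1 \<le> k"
  shows "s / (4 * real m) * (\<Sum>i<m. indicator (wrong_bit k B i) q) \<le> (hellinger_dist k (hard_pmf s m B) q)\<^sup>2"
proof -
  define p where "p = hard_pmf s m B"
  define h where "h j = (sqrt (pmf p j) - sqrt (pmf q j))\<^sup>2" for j
  have "s / (2 * real m) * indicator (wrong_bit k B i) q \<le> h (2 * i + 2) + h (2 * i + 3)" if i: "i < m" for i
  proof (cases "q \<in> wrong_bit k B i")
    case True
    define a where "a = sqrt (s / real m)"
    have a2: "a\<^sup>2 / 2 = s / (2 * real m)" using s by (simp add: a_def)
    have pair: "2 * i + 3 \<noteq> hard_point B i'" "2 * i + 2 = hard_point B i" if "i \<in> B" for i'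
      using that unfolding hard_point_def by (auto split: if_splits) presburger
    have pair': "2 * i + 2 \<noteq> hard_point B i'" "2 * i + 3 = hard_point B i" if "i \<notin> B" for i'
      using that unfolding hard_point_def by (auto split: if_splits) presburger
    show ?thesis
    proof (cases "i \<in> B")
      case True
      have "sqrt (pmf p (2 * i + 2)) = a" "sqrt (pmf p (2 * i + 3)) = 0"
        using pair[OF True] i
        by (auto simp: p_def pmf_hard_pmf[OF m s] hard_weight_def a_def)
      moreover have "pmf q (2 * i + 2) \<le> pmf q (2 * i + 3)"
        using \<open>q \<in> wrong_bit k B i\<close> True by (auto simp: wrong_bit_def)
      ultimately show ?thesis
        using wrong_pair_cost[of "sqrt (pmf q (2 * i + 2))" "sqrt (pmf q (2 * i + 3))" a]
          \<open>q \<in> wrong_bit k B i\<close> by (simp add: h_def a2)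
    next
      case False
      have "sqrt (pmf p (2 * i + 3)) = a" "sqrt (pmf p (2 * i + 2)) = 0"
        using pair'[OF False] i
        by (auto simp: p_def pmf_hard_pmf[OF m s] hard_weight_def a_def)
      \<comment> \<open>Ties are decoded as \<open>i \<in> B\<close>, so they count as wrong
        here.\<close>
      moreover have "pmf q (2 * i + 3) \<le> pmf q (2 * i + 2)"
        using \<open>q \<in> wrong_bit k B i\<close> False by (auto simp: wrong_bit_def)
      ultimately show ?thesis
        using wrong_pair_cost[of "sqrt (pmf q (2 * i + 3))" "sqrt (pmf q (2 * i + 2))" a]
          \<open>q \<in> wrong_bit k B i\<close> by (simp add: h_def a2)
    qed
  qed (simp add: h_def)
  then have "(\<Sum>i<m. s / (2 * real m) * indicator (wrong_bit k B i) q) \<le> (\<Sum>i<m. h (2 * i + 2) + h (2 * i + 3))"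
    by (intro sum_mono) auto
  also have "\<dots> \<le> (\<Sum>j=1..k. h j)" by (rule sum_pairs_le[OF k]) (simp add: h_def)
  finally have "s / (2 * real m) * (\<Sum>i<m. indicator (wrong_bit k B i) q) \<le> (\<Sum>j=1..k. h j)"
    unfolding sum_distrib_left .
  then show ?thesis
    by (simp add: hellinger_dist_sq_eq_half_sum h_def p_def)
qed

text \<open>\<open>G B i\<close> is the probability of decoding bit \<open>i\<close> wrongly when
  the truth is \<open>p B\<close>. Accuracy bounds its sum over \<open>i\<close> for every
  \<open>B\<close>, whereas a sample that misses the \<open>i\<close>-th pair carries no information
  on bit \<open>i\<close>. Averaging over all \<open>B\<close> brings the two together.\<close>

lemma learnable_hellinger_size_lower:
  assumes k: "k \<ge> 4" and \<epsilon>: "0 < \<epsilon>" "\<epsilon> \<le> 1/8" and \<delta>: "0 < \<delta>" "\<delta> \<le> 1/16"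
    and "learnable (hellinger_dist k) k \<epsilon> \<delta> n"
  shows "real k / (256 * \<epsilon>\<^sup>2) \<le> real n"
proof -
  from assms(6) obtain A where A: "A \<in> randomized_estimators k n"
    and success: "\<And>p. p \<in> distributions k \<Longrightarrow> success_prob (hellinger_dist k) k n \<epsilon> A p \<ge> 1 - \<delta>"
    by (auto simp: learnable_def)
  define m where "m = (k - 1) div 2"
  have m: "m > 0" "2 * m + 1 \<le> k" "k \<le> 4 * m" using k by (auto simp: m_def)
  \<comment> \<open>With \<open>32\<close>, an estimate within \<epsilon> has at most
    \<open>4 * m * \<epsilon>\<^sup>2 / s = m / 8\<close> wrong bits.\<close>
  define s where "s = 32 * \<epsilon>\<^sup>2"
  have "\<epsilon>\<^sup>2 \<le> (1/8)\<^sup>2" using \<epsilon> by (intro power_mono) auto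
  then have s: "0 < s" "s \<le> 1" using \<epsilon> by (auto simp: s_def power2_eq_square)
  define p where "p B = hard_pmf s m B" for B
  have p: "p B \<in> distributions k" for B using m s by (simp add: p_def hard_pmf_in_distributions)
  then have fin_p: "finite (set_pmf (p B))" for B by (auto simp: distributions_def intro: finite_subset)
  note fin = finite_set_replicate_pmf[OF fin_p]
  define G where "G B i = measure_pmf.expectation (replicate_pmf n (p B)) (\<lambda>xs. measure (A xs) (wrong_bit k B i))" for B i
  \<comment> \<open>\<open>3 / 16 = 1 / 8 + 1 / 16\<close>: at most \<open>m / 8\<close> wrong bits
    on success, and at most \<open>m\<close> on failure, which has probability at most
    \<open>1 / 16\<close>.\<close>
  have G_upper: "(\<Sum>i<m. G B i) \<le> 3 / 16 * real m" for B
  proof -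
    define ball where "ball = {q \<in> distributions k. hellinger_dist k (p B) q \<le> \<epsilon>}"
    have wrong_le: "(\<Sum>i<m. indicator (wrong_bit k B i) q) \<le> real m / 8 + real m * (1 - indicator ball q)"
      if q: "q \<in> distributions k" for q
    proof (cases "q \<in> ball")
      case True
      then have "(hellinger_dist k (p B) q)\<^sup>2 \<le> \<epsilon>\<^sup>2"
        by (auto simp: ball_def intro!: power_mono hellinger_dist_nonneg)
      then have "s / (4 * real m) * (\<Sum>i<m. indicator (wrong_bit k B i) q) \<le> \<epsilon>\<^sup>2"
        using wrong_bits_le_hellinger[of m s k B q] m s by (simp add: p_def)
      then have "s * (\<Sum>i<m. indicator (wrong_bit k B i) q) \<le> s * (real m / 8)"
        using m by (simp add: s_def field_simps)
      then show ?thesis using True s by (simp del: sum_indicator_eq_card)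
    next
      case False
      have "(\<Sum>i<m. indicator (wrong_bit k B i) q) \<le> (\<Sum>i<m. 1 :: real)"
        by (intro sum_mono) (auto simp: indicator_def)
      then show ?thesis using False by simp
    qed
    have "(\<Sum>i<m. G B i) =
      measure_pmf.expectation (replicate_pmf n (p B)) (\<lambda>xs. \<Sum>i<m. measure (A xs) (wrong_bit k B i))"
      unfolding G_def by (intro Bochner_Integration.integral_sum[symmetric] integrable_measure_pmf_finite[OF fin])
    also have "\<dots> \<le> measure_pmf.expectation (replicate_pmf n (p B))
        (\<lambda>xs. real m / 8 + real m * (1 - measure (A xs) ball))"
    proof (intro integral_mono_AE integrable_measure_pmf_finite[OF fin] AE_pmfI)
      fix xs assume "xs \<in> set_pmf (replicate_pmf n (p B))"
      then have xs: "length xs = n" "set xs \<subseteq> {1..k}"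
        using p[of B] by (auto simp: set_replicate_pmf distributions_def)
      interpret prob_space "A xs" by (rule prob_space_estimator[OF A xs])
      note sets = prob_space_estimator(2)[OF A xs]
      have meas [measurable]: "ball \<in> sets (A xs)" "wrong_bit k B i \<in> sets (A xs)" for i
        unfolding sets by (auto simp: ball_def hellinger_ball_measurable wrong_bit_measurable)
      have "(\<Sum>i<m. prob (wrong_bit k B i)) = expectation (\<lambda>q. \<Sum>i<m. indicator (wrong_bit k B i) q)"
        using meas by (subst Bochner_Integration.integral_sum) (auto simp: less_top[symmetric])
      also have "\<dots> \<le> expectation (\<lambda>q. real m / 8 + real m * (1 - indicator ball q))"
        using prob_space_estimator(3)[OF A xs]
        by (intro integral_mono wrong_le) (auto simp: less_top[symmetric])
      also have "\<dots> = real m / 8 + real m * (1 - prob ball)"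
        using meas by (simp add: prob_space less_top[symmetric])
      finally show "(\<Sum>i<m. prob (wrong_bit k B i)) \<le> real m / 8 + real m * (1 - prob ball)" .
    qed
    also have "\<dots> = real m / 8 + real m * (1 - success_prob (hellinger_dist k) k n \<epsilon> A (p B))"
      unfolding success_prob_def ball_def[symmetric]
      by (simp add: integrable_measure_pmf_finite[OF fin])
    also have "\<dots> \<le> real m / 8 + real m * (1 / 16)"
      using success[OF p[of B]] \<delta> by (intro add_left_mono mult_left_mono) auto
    finally show ?thesis by simp
  qed
  define flip where "flip i B = (if i \<in> B then B - {i} else insert i B)" for i :: nat and B
  \<comment> \<open>Flipping bit \<open>i\<close> changes the distribution only on the
    \<open>i\<close>-th pair; \<open>R\<close> is its complement, of mass
    \<open>1 - s / m\<close>.\<close>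
  have G_lower: "1 - real n * s / real m \<le> G B i + G (flip i B) i" if i: "i < m" for B i
  proof -
    define R where "R = {1..k} - {2 * i + 2, 2 * i + 3}"
    have pmf_eq: "pmf (p B) x = pmf (p (flip i B)) x" if "x \<in> R" for x
    proof -
      have off: "hard_point B i \<noteq> x" "hard_point (flip i B) i \<noteq> x"
        using that by (auto simp: R_def hard_point_def)
      have same: "hard_point (flip i B) j = hard_point B j" if "j \<noteq> i" for j
        using that by (auto simp: flip_def hard_point_def)
      have "x \<in> hard_point B ` {..<m} \<longleftrightarrow> x \<in> hard_point (flip i B) ` {..<m}"
        unfolding image_iff using off same by metis
      then show ?thesis using m s by (simp add: p_def pmf_hard_pmf hard_weight_def)
    qed
    have "1 - s / real m \<le> (\<Sum>x\<in>R. pmf (p B) x)"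
    proof -
      have hp: "hard_point B i \<in> {2 * i + 2, 2 * i + 3}" by (simp add: hard_point_def)
      have "1 = (\<Sum>x=1..k. pmf (p B) x)"
        using p[of B] by (simp add: distributions_def sum_pmf_eq_1)
      also have "\<dots> = (\<Sum>x\<in>R. pmf (p B) x) + (\<Sum>x\<in>{2 * i + 2, 2 * i + 3}. pmf (p B) x)"
        unfolding R_def using i m by (intro sum.subset_diff) auto
      also have "(\<Sum>x\<in>{2 * i + 2, 2 * i + 3}. pmf (p B) x) = (\<Sum>x\<in>{hard_point B i}. pmf (p B) x)"
      proof (rule sum.mono_neutral_right)
        show "\<forall>x\<in>{2 * i + 2, 2 * i + 3} - {hard_point B i}. pmf (p B) x = 0"
        proof
          fix x assume x: "x \<in> {2 * i + 2, 2 * i + 3} - {hard_point B i}"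
          have "x \<noteq> hard_point B j" for j
          proof (cases "j = i")
            case False
            then show ?thesis using x by (auto simp: hard_point_def)
          qed (use x in auto)
          then show "pmf (p B) x = 0" using x m s by (auto simp: p_def pmf_hard_pmf hard_weight_def)
        qed
      qed (use hp in auto)
      also have "\<dots> = s / real m"
        using i m s by (auto simp: p_def pmf_hard_pmf hard_weight_def hard_point_def)
      finally show ?thesis by simp
    qed
    moreover have s_le: "s / real m \<le> 1" using m(1) s by (simp add: divide_le_eq)
    ultimately have "(1 - s / real m) ^ n \<le> (\<Sum>x\<in>R. pmf (p B) x) ^ n"
      using s_le by (intro power_mono) auto
    also have "\<dots> \<le> G B i + G (flip i B) i"
      unfolding G_def
    proof (rule expectation_replicate_pmf_pair_ge)
      fix xs assume "length xs = n" "set xs \<subseteq> R"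
      then have xs: "length xs = n" "set xs \<subseteq> {1..k}" by (auto simp: R_def)
      interpret prob_space "A xs" by (rule prob_space_estimator[OF A xs])
      \<comment> \<open>Every estimate decodes the bit wrongly for exactly one of \<open>B\<close>
        and \<open>flip i B\<close>.\<close>
      have "space (A xs) - wrong_bit k B i = wrong_bit k (flip i B) i"
        unfolding prob_space_estimator(3)[OF A xs] by (auto simp: wrong_bit_def flip_def split: if_splits)
      moreover have "wrong_bit k B i \<in> events"
        unfolding prob_space_estimator(2)[OF A xs] by (rule wrong_bit_measurable)
      ultimately show "1 \<le> prob (wrong_bit k B i) + prob (wrong_bit k (flip i B) i)"
        using prob_compl[of "wrong_bit k B i"] by simp
    qed (auto simp: R_def fin_p pmf_eq)
    finally have "(1 - s / real m) ^ n \<le> G B i + G (flip i B) i" .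
    \<comment> \<open>Bernoulli's inequality makes the bound linear in \<open>n\<close>.\<close>
    moreover have "1 + real n * (- (s / real m)) \<le> (1 + (- (s / real m))) ^ n"
      using s_le by (intro Bernoulli_inequality) auto
    ultimately show ?thesis by simp
  qed
  let ?\<B> = "Pow {..<m}"
  have card: "card ?\<B> = 2 ^ m" by (simp add: card_Pow)
  have "(1 - real n * s / real m) * 2 ^ m \<le> 2 * (\<Sum>B\<in>?\<B>. G B i)" if i: "i < m" for i
  proof -
    \<comment> \<open>\<open>flip i\<close> is an involution on the bit strings, so averaging
      replaces the pair by twice a single term.\<close>
    have "(\<Sum>B\<in>?\<B>. G (flip i B) i) = (\<Sum>B\<in>?\<B>. G B i)"
      by (rule sum.reindex_bij_witness[of _ "flip i" "flip i"]) (use i in \<open>auto simp: flip_def\<close>)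
    moreover have "(\<Sum>B\<in>?\<B>. 1 - real n * s / real m) \<le> (\<Sum>B\<in>?\<B>. G B i + G (flip i B) i)"
      by (intro sum_mono G_lower i)
    ultimately show ?thesis by (simp add: sum.distrib card mult.commute)
  qed
  then have "(\<Sum>i<m. (1 - real n * s / real m) * 2 ^ m) \<le> (\<Sum>i<m. 2 * (\<Sum>B\<in>?\<B>. G B i))"
    by (intro sum_mono) auto
  also have "\<dots> = 2 * (\<Sum>B\<in>?\<B>. \<Sum>i<m. G B i)"
    unfolding sum_distrib_left[symmetric] by (subst sum.swap) simp
  also have "\<dots> \<le> 2 * (\<Sum>B\<in>?\<B>. 3 / 16 * real m)"
    by (intro mult_left_mono sum_mono G_upper) auto
  finally have "real m * 2 ^ m * (1 - real n * s / real m) \<le> real m * 2 ^ m * (3 / 8)"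
    by (simp add: card mult_ac)
  then have "1 - real n * s / real m \<le> 3 / 8"
    using m by (subst (asm) mult_le_cancel_left_pos) auto
  then have "5 * real m \<le> 256 * (real n * \<epsilon>\<^sup>2)"
    using m by (simp add: s_def field_simps)
  moreover have "real k \<le> 4 * real m" using m(3) by linarith
  ultimately have "real k \<le> 256 * (real n * \<epsilon>\<^sup>2)" by linarith
  then show ?thesis using \<epsilon> by (simp add: field_simps)
qed

theorem theorem2:
  "\<exists>(c::real) (C::real) (k\<^sub>0::nat) (\<epsilon>\<^sub>0::real) (\<delta>\<^sub>0::real).
     0 < c \<and> c \<le> C \<and> 0 < \<epsilon>\<^sub>0 \<and> 0 < \<delta>\<^sub>0 \<and>
     (\<forall>k \<epsilon> \<delta>. k\<^sub>0 \<le> k \<and> 0 < \<epsilon> \<and> \<epsilon> \<le> \<epsilon>\<^sub>0 \<and> 0 < \<delta> \<and> \<delta> \<le> \<delta>\<^sub>0 \<and> \<delta> \<le> 1 \<longrightarrow>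
        ereal (c * ((real k + ln (1 / \<delta>)) / \<epsilon>\<^sup>2))
          \<le> ereal_of_enat (sample_complexity (hellinger_dist k) k \<epsilon> \<delta>) \<and>
        ereal_of_enat (sample_complexity (hellinger_dist k) k \<epsilon> \<delta>)
          \<le> ereal (C * ((real k + ln (1 / \<delta>)) / \<epsilon>\<^sup>2)))"
\<comment> \<open>The thresholds are those of the two lower bounds, and \<open>3\<close> comes from
  the upper bound. Averaging two lower bounds with denominator \<open>256\<close> gives
  \<open>1 / 512\<close>.\<close>
proof (rule exI[of _ "1/512"], rule exI[of _ 3], rule exI[of _ 4], rule exI[of _ "1/8"],
    rule exI[of _ "1/16"], intro conjI allI impI)
  fix k :: nat and \<epsilon> \<delta> :: real
  assume "4 \<le> k \<and> 0 < \<epsilon> \<and> \<epsilon> \<le> 1/8 \<and> 0 < \<delta> \<and> \<delta> \<le> 1/16 \<and> \<delta> \<le> 1"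
  then have k: "4 \<le> k" and \<epsilon>: "0 < \<epsilon>" "\<epsilon> \<le> 1/8" and \<delta>: "0 < \<delta>" "\<delta> \<le> 1/16" by auto
  let ?g = "(real k + ln (1 / \<delta>)) / \<epsilon>\<^sup>2"
  let ?N = "{enat n | n. learnable (hellinger_dist k) k \<epsilon> \<delta> n}"
  obtain n where n: "learnable (hellinger_dist k) k \<epsilon> \<delta> n" "real n \<le> 3 * ?g"
    using learnable_hellinger_upper[of k \<epsilon> \<delta>] k \<epsilon> \<delta> by auto
  have "sample_complexity (hellinger_dist k) k \<epsilon> \<delta> \<le> enat n"
    unfolding sample_complexity_def using n(1) by (intro Inf_lower) auto
  then have "ereal_of_enat (sample_complexity (hellinger_dist k) k \<epsilon> \<delta>) \<le> ereal_of_enat (enat n)"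
    by (simp only: ereal_of_enat_le_iff)
  also have "\<dots> \<le> ereal (3 * ?g)" using n(2) by simp
  finally show "ereal_of_enat (sample_complexity (hellinger_dist k) k \<epsilon> \<delta>) \<le> ereal (3 * ?g)" .
  \<comment> \<open>By well-ordering the infimum of the nonempty set is attained, so the lower
    bounds apply to the sample complexity itself.\<close>
  have "Inf ?N \<in> ?N" by (rule wellorder_InfI[of "enat n"]) (use n in auto)
  then obtain l where l: "sample_complexity (hellinger_dist k) k \<epsilon> \<delta> = enat l"
    "learnable (hellinger_dist k) k \<epsilon> \<delta> l"
    unfolding sample_complexity_def by blast
  have "real k / (256 * \<epsilon>\<^sup>2) \<le> real l"
    by (rule learnable_hellinger_size_lower) (use k \<epsilon> \<delta> l in auto)
  moreover have "ln (1 / \<delta>) / (256 * \<epsilon>\<^sup>2) \<le> real l"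
  proof -
    have "ln (1 / \<delta>) / (256 * \<epsilon>\<^sup>2) \<le> ln (1 / \<delta>) / (36 * \<epsilon>\<^sup>2)"
      using \<epsilon> \<delta> by (intro divide_left_mono) auto
    also have "\<dots> \<le> real l"
      by (rule learnable_hellinger_log_lower[of k]) (use k \<epsilon> \<delta> l in auto)
    finally show ?thesis .
  qed
  ultimately have "(real k / (256 * \<epsilon>\<^sup>2) + ln (1 / \<delta>) / (256 * \<epsilon>\<^sup>2)) / 2 \<le> (real l + real l) / 2"
    by (intro divide_right_mono add_mono) auto
  also have "(real k / (256 * \<epsilon>\<^sup>2) + ln (1 / \<delta>) / (256 * \<epsilon>\<^sup>2)) / 2 = 1/512 * ?g"
    using \<epsilon> by (simp add: field_simps)
  finally have "1/512 * ?g \<le> real l" by simp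
  then show "ereal (1/512 * ?g) \<le> ereal_of_enat (sample_complexity (hellinger_dist k) k \<epsilon> \<delta>)"
    by (simp add: l(1))
qed auto

end
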